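(* Let $p>2$ and let $\kappa>1$ be a constant. Let $\eta_p=\mathbb{E}[\|g\|_p]$ where $g$ is an $n$-dimensional vector of i.i.d. standard Gaussians. If $(\mathcal{S},f)$ is a $(k,\kappa)$-sketching family for the $1\to p$ norm of $n\times n$ real matrices, then $k=\Omega(n^2/\eta_p^2)$. In particular, $k=\Omega(n^{2-2/p})$ when $p<\infty$, and $k=\Omega(n^2/\log n)$ when $p=\infty$.
   Context: $\|A\|_{q\to p}=\sup_{x\ne0}\frac{\|Ax\|_p}{\|x\|_q}$. A $(k,\alpha)$-sketching family for the $q\to p$ norm is a pair $(\mathcal{S},f)$ where $\mathcal{S}$ is a distribution over linear maps $L:\mathbb{R}^{n\times n}\to\mathbb{R}^k$ and $f:\mathbb{R}^k\to\mathbb{R}$, such that for every $A$, $\Pr_{L\sim\mathcal{S}}\big[f(L(A))\in(\tfrac1\alpha\|A\|_{q\to p},\,\alpha\|A\|_{q\to p})\big]\ge \frac56$. *)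

theory Defs
  imports "HOL-Probability.Probability"
begin

text \<open>
  The dimensions n and k are quantified inside the asymptotic statement, so vectors and matrices
  are functions on the indices below n (entries elsewhere are ignored).
  Exponents range over extended reals, to include the exponent infinity.
\<close>

definition lp_norm :: "ereal \<Rightarrow> nat \<Rightarrow> (nat \<Rightarrow> real) \<Rightarrow> real" where
  "lp_norm p n x =
     (if p = \<infinity> then (MAX i\<in>{..<n}. \<bar>x i\<bar>)
      else (\<Sum>i<n. \<bar>x i\<bar> powr real_of_ereal p) powr (1 / real_of_ereal p))"

definition mat_vec :: "nat \<Rightarrow> (nat \<Rightarrow> nat \<Rightarrow> real) \<Rightarrow> (nat \<Rightarrow> real) \<Rightarrow> nat \<Rightarrow> real" where
  "mat_vec n A x = (\<lambda>i. \<Sum>j<n. A i j * x j)"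

definition op_norm :: "ereal \<Rightarrow> ereal \<Rightarrow> nat \<Rightarrow> (nat \<Rightarrow> nat \<Rightarrow> real) \<Rightarrow> real" where
  "op_norm q p n A =
     (SUP x\<in>{x. \<exists>i<n. x i \<noteq> 0}. lp_norm p n (mat_vec n A x) / lp_norm q n x)"

text \<open>
  A linear map from n-by-n matrices to k-dimensional space is given by its coefficient array;
  the space of these arrays carries the (product) Borel sigma-algebra.
\<close>

definition linear_maps :: "nat \<Rightarrow> nat \<Rightarrow> (nat \<times> nat \<times> nat \<Rightarrow> real) measure" where
  "linear_maps n k = (\<Pi>\<^sub>M t\<in>{..<k} \<times> {..<n} \<times> {..<n}. borel)"

text \<open>
  The restriction to indices below k matters: without it, the unspecified values of L outside
  its index set could pass information about A to the estimator.
\<close>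

definition apply_map ::
  "nat \<Rightarrow> nat \<Rightarrow> (nat \<times> nat \<times> nat \<Rightarrow> real) \<Rightarrow> (nat \<Rightarrow> nat \<Rightarrow> real) \<Rightarrow> nat \<Rightarrow> real" where
  "apply_map n k L A = (\<lambda>r\<in>{..<k}. \<Sum>i<n. \<Sum>j<n. L (r, i, j) * A i j)"

text \<open>
  Only nonzero A are required to be handled: for A = 0 the open interval is empty, so including
  it would leave no sketching families at all. No measurability of f is assumed; since
  non-measurable events have measure 0, the bound 5/6 already makes the events in question
  measurable.
\<close>

definition sketching_family ::
  "ereal \<Rightarrow> ereal \<Rightarrow> nat \<Rightarrow> nat \<Rightarrow> real \<Rightarrow> (nat \<times> nat \<times> nat \<Rightarrow> real) measure
    \<Rightarrow> ((nat \<Rightarrow> real) \<Rightarrow> real) \<Rightarrow> bool" where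
  "sketching_family q p n k \<alpha> S f \<longleftrightarrow>
     prob_space S \<and> sets S = sets (linear_maps n k) \<and>
     (\<forall>A. (\<exists>i<n. \<exists>j<n. A i j \<noteq> 0) \<longrightarrow>
       \<P>(L in S. f (apply_map n k L A) \<in> {1 / \<alpha> * op_norm q p n A <..< \<alpha> * op_norm q p n A})
         \<ge> 5 / 6)"

definition gaussian_vector :: "nat \<Rightarrow> (nat \<Rightarrow> real) measure" where
  "gaussian_vector n = (\<Pi>\<^sub>M i\<in>{..<n}. density lborel (\<lambda>x. ennreal (std_normal_density x)))"

definition eta :: "ereal \<Rightarrow> nat \<Rightarrow> real" where
  "eta p n = (LINT g|gaussian_vector n. lp_norm p n g)"

end

theory Submission
  imports Defs
begin

text \<open>
  Take T = n^(1/p) (T = 1 for p infinite) and a random matrix G with independent entries in (0, 1),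
  so that its norm is at most T; adding a spike of height s = \<open>\<kappa>\<close>^2 T to one entry makes the norm
  exceed \<open>\<kappa>\<close>^2 T. A sketching family must therefore tell G from G plus spike, for every spike position.
  For fixed L, the sketch of the spike at position a equals the sketch of s times the a-th column of
  the orthogonal projection onto the row space of L. The squared lengths of these n^2 columns sum to
  the rank, at most k. If the entries of G have a density whose square root is Lipschitz, translating
  G by w is invisible up to O(|w|) in total variation. Averaging over a and over L gives
  k = \<open>\<Omega>\<close>(n^2 / T^2), and \<open>\<eta>\<^sub>p\<close> is at least T E|g| by the power mean inequality.
  Bounded noise in place of Gaussian noise makes the upper bound on the norm deterministic.
\<close>

subsection \<open>Norms\<close>

lemma lp_norm_one: "lp_norm 1 n x = (\<Sum>i<n. \<bar>x i\<bar>)"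
proof -
  have "(0::real) \<le> (\<Sum>i<n. \<bar>x i\<bar>)"
    by (simp add: sum_nonneg)
  then show ?thesis
    by (simp add: lp_norm_def)
qed

lemma ereal_real_ge_1:
  assumes "1 \<le> p" "p \<noteq> \<infinity>"
  shows "1 \<le> real_of_ereal p"
  using assms by (cases p) auto

lemma lp_norm_ge_entry:
  assumes "1 \<le> p" "i < n"
  shows "\<bar>x i\<bar> \<le> lp_norm p n x"
proof (cases "p = \<infinity>")
  case True
  then show ?thesis
    using assms by (auto simp: lp_norm_def intro!: Max_ge)
next
  case False
  define q where "q = real_of_ereal p"
  have q: "1 \<le> q"
    using ereal_real_ge_1[OF assms(1) False] by (simp add: q_def)
  have "\<bar>x i\<bar> powr q \<le> (\<Sum>i<n. \<bar>x i\<bar> powr q)"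
    using assms(2) by (intro member_le_sum) auto
  then have "(\<bar>x i\<bar> powr q) powr (1 / q) \<le> (\<Sum>i<n. \<bar>x i\<bar> powr q) powr (1 / q)"
    using q by (intro powr_mono2) auto
  then show ?thesis
    using q False by (simp add: powr_powr lp_norm_def q_def)
qed

lemma lp_norm_nonneg:
  assumes "1 \<le> p" "0 < n"
  shows "0 \<le> lp_norm p n x"
  using lp_norm_ge_entry[OF assms, of x] by linarith

text \<open>One formula serves both cases: \<open>real_of_ereal \<infinity>\<close> is 0 and
  division by 0 gives 0, so for infinite \<open>p\<close> the factor is
  \<open>real n powr 0\<close>, which is 1 for positive \<open>n\<close>.\<close>

lemma lp_norm_le_bound:
  assumes "1 \<le> p" "0 < n" and x: "\<And>i. i < n \<Longrightarrow> \<bar>x i\<bar> \<le> M"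
  shows "lp_norm p n x \<le> M * real n powr (1 / real_of_ereal p)"
proof (cases "p = \<infinity>")
  case True
  then show ?thesis
    using assms by (auto simp: lp_norm_def intro!: Max.boundedI)
next
  case False
  define q where "q = real_of_ereal p"
  have q: "1 \<le> q"
    using ereal_real_ge_1[OF assms(1) False] by (simp add: q_def)
  have M: "0 \<le> M"
    using x[OF assms(2)] by linarith
  have "(\<Sum>i<n. \<bar>x i\<bar> powr q) \<le> (\<Sum>i<n. M powr q)"
    using q x by (intro sum_mono powr_mono2) auto
  then have "(\<Sum>i<n. \<bar>x i\<bar> powr q) powr (1 / q) \<le> (real n * M powr q) powr (1 / q)"
    using q by (intro powr_mono2) (auto intro: sum_nonneg)
  also have "\<dots> = M * real n powr (1 / q)"
    using q M by (simp add: powr_mult powr_powr)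
  finally show ?thesis
    using False by (simp add: lp_norm_def q_def)
qed

lemma lp_norm_single:
  assumes "1 \<le> p" "0 < n" "\<And>i. i \<noteq> 0 \<Longrightarrow> x i = 0"
  shows "lp_norm p n x = \<bar>x 0\<bar>"
proof (cases "p = \<infinity>")
  case True
  have "(MAX i\<in>{..<n}. \<bar>x i\<bar>) = \<bar>x 0\<bar>"
  proof (rule Max_eqI)
    fix y assume "y \<in> (\<lambda>i. \<bar>x i\<bar>) ` {..<n}"
    then obtain i where "y = \<bar>x i\<bar>" by auto
    then show "y \<le> \<bar>x 0\<bar>"
      using assms(3)[of i] by (cases "i = 0") auto
  qed (use assms in auto)
  then show ?thesis
    using True by (simp add: lp_norm_def)
next
  case False
  define q where "q = real_of_ereal p"
  have q: "1 \<le> q"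
    using ereal_real_ge_1[OF assms(1) False] by (simp add: q_def)
  have "(\<Sum>i<n. \<bar>x i\<bar> powr q) = (\<Sum>i<n. if i = 0 then \<bar>x 0\<bar> powr q else 0)"
    using assms(3) by (intro sum.cong) auto
  then have "(\<Sum>i<n. \<bar>x i\<bar> powr q) = \<bar>x 0\<bar> powr q"
    using assms(2) by simp
  then show ?thesis
    using False q by (simp add: lp_norm_def q_def[symmetric] powr_powr)
qed

text \<open>The power mean inequality, by Young's inequality for \<open>\<bar>x i\<bar> / M\<close>
  and 1, where \<open>M\<close> is the \<open>q\<close>-mean of the entries.\<close>

lemma lp_norm_ge_mean:
  assumes "1 < p" "0 < n"
  shows "real n powr (1 / real_of_ereal p) * (\<Sum>i<n. \<bar>x i\<bar>) / real n \<le> lp_norm p n x"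
proof (cases "p = \<infinity>")
  case True
  have "(\<Sum>i<n. \<bar>x i\<bar>) \<le> (\<Sum>i<n. lp_norm p n x)"
    using assms by (intro sum_mono lp_norm_ge_entry) auto
  then show ?thesis
    using True assms(2) by (simp add: field_simps)
next
  case False
  define q where "q = real_of_ereal p"
  have q: "1 < q"
    using assms(1) False by (cases p) (auto simp: q_def)
  define M where "M = lp_norm p n x / real n powr (1 / q)"
  have n: "0 < real n powr (1 / q)"
    using assms(2) by simp
  have N0: "0 \<le> lp_norm p n x"
    using assms by (intro lp_norm_nonneg) auto
  have "(\<Sum>i<n. \<bar>x i\<bar>) \<le> real n * M"
  proof (cases "lp_norm p n x = 0")
    case True
    have "x i = 0" if "i < n" for i
      using lp_norm_ge_entry[of p i n x] assms True that by auto
    then have "(\<Sum>i<n. \<bar>x i\<bar>) = 0"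
      by simp
    then show ?thesis
      using True by (simp add: M_def)
  next
    case nz: False
    then have M: "0 < M"
      using N0 n by (simp add: M_def)
    define r where "r = q / (q - 1)"
    have r: "1 < r" "1 / q + 1 / r = 1"
      using q by (auto simp: r_def field_simps)
    have Mq: "M powr q = (\<Sum>i<n. \<bar>x i\<bar> powr q) / real n"
      using q False sum_nonneg[of "{..<n}" "\<lambda>i. \<bar>x i\<bar> powr q"] assms(2)
      by (simp add: M_def lp_norm_def q_def[symmetric] powr_divide powr_powr)
    have Mq0: "0 < M powr q"
      using M by simp
    \<comment> \<open>After summation the first terms give \<open>n / q\<close>, because the
      \<open>q\<close>-th powers of \<open>\<bar>x i\<bar> / M\<close> average to 1, and the second
      give \<open>n / r\<close>; conjugacy makes the total \<open>n\<close>.\<close>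
    have "(\<Sum>i<n. \<bar>x i\<bar> / M * 1) \<le> (\<Sum>i<n. (\<bar>x i\<bar> / M) powr q / q + 1 powr r / r)"
      using q r M by (intro sum_mono Youngs_inequality) auto
    also have "\<dots> = (\<Sum>i<n. \<bar>x i\<bar> powr q) / M powr q / q + real n / r"
      using M by (simp add: sum.distrib powr_divide sum_divide_distrib)
    also have "(\<Sum>i<n. \<bar>x i\<bar> powr q) = real n * M powr q"
      using assms(2) by (simp add: Mq)
    also have "real n * M powr q / M powr q / q + real n / r = real n * (1 / q + 1 / r)"
      using Mq0 by (simp add: field_simps)
    finally show ?thesis
      using M r by (simp add: sum_divide_distrib[symmetric] field_simps)
  qed
  then show ?thesis
    using n assms(2) by (simp add: M_def q_def[symmetric] field_simps)
qed

section \<open>Operator norms from l1 to lp\<close>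

lemma op_norm_ratio_le:
  assumes p: "1 \<le> p" "0 < n" and A: "\<And>i j. i < n \<Longrightarrow> j < n \<Longrightarrow> \<bar>A i j\<bar> \<le> M"
    and x: "\<exists>i<n. x i \<noteq> 0"
  shows "lp_norm p n (mat_vec n A x) / lp_norm 1 n x \<le> M * real n powr (1 / real_of_ereal p)"
proof -
  obtain i0 where i0: "i0 < n" "x i0 \<noteq> 0"
    using x by auto
  have pos: "0 < (\<Sum>j<n. \<bar>x j\<bar>)"
    using i0 by (intro sum_pos2[of _ i0]) auto
  have "\<bar>mat_vec n A x i\<bar> \<le> M * (\<Sum>j<n. \<bar>x j\<bar>)" if "i < n" for i
  proof -
    have "\<bar>mat_vec n A x i\<bar> \<le> (\<Sum>j<n. \<bar>A i j * x j\<bar>)"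
      by (simp add: mat_vec_def)
    also have "\<dots> \<le> (\<Sum>j<n. M * \<bar>x j\<bar>)"
      using A that by (intro sum_mono) (auto simp: abs_mult intro!: mult_right_mono)
    finally show ?thesis
      by (simp add: sum_distrib_left)
  qed
  from lp_norm_le_bound[OF p this] show ?thesis
    using pos by (simp add: lp_norm_one field_simps)
qed

lemma op_norm_le_bound:
  assumes "1 \<le> p" "0 < n" "\<And>i j. i < n \<Longrightarrow> j < n \<Longrightarrow> \<bar>A i j\<bar> \<le> M"
  shows "op_norm 1 p n A \<le> M * real n powr (1 / real_of_ereal p)"
  unfolding op_norm_def
proof (rule cSUP_least)
  show "{x. \<exists>i<n. x i \<noteq> 0} \<noteq> ({} :: (nat \<Rightarrow> real) set)"
    using assms(2) by (auto intro!: exI[of _ "\<lambda>_. 1"] exI[of _ 0])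
qed (use op_norm_ratio_le[OF assms] in auto)

lemma op_norm_ge_ratio:
  assumes "1 \<le> p" "0 < n" "\<exists>i<n. x i \<noteq> 0"
  shows "lp_norm p n (mat_vec n A x) / lp_norm 1 n x \<le> op_norm 1 p n A"
  unfolding op_norm_def
proof (rule cSUP_upper)
  \<comment> \<open>Any common bound on the entries will do: it makes the set of ratios bounded
    above, so that the real-valued supremum is an actual upper bound.\<close>
  define M where "M = (\<Sum>i<n. \<Sum>j<n. \<bar>A i j\<bar>)"
  have M: "\<bar>A i j\<bar> \<le> M" if "i < n" "j < n" for i j
  proof -
    have "\<bar>A i j\<bar> \<le> (\<Sum>j<n. \<bar>A i j\<bar>)"
      using that by (intro member_le_sum) auto
    also have "\<dots> \<le> M"
      unfolding M_def using that
      by (intro member_le_sum[of i _ "\<lambda>i. \<Sum>j<n. \<bar>A i j\<bar>"]) (auto intro: sum_nonneg)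
    finally show ?thesis .
  qed
  show "bdd_above ((\<lambda>x. lp_norm p n (mat_vec n A x) / lp_norm 1 n x) ` {x. \<exists>i<n. x i \<noteq> 0})"
    using op_norm_ratio_le[where A = A and M = M, OF assms(1,2) M] by (auto intro!: bdd_aboveI2)
qed (use assms in auto)

text \<open>Testing on the \<open>j\<close>-th unit vector yields the \<open>j\<close>-th column of
  \<open>A\<close>, whose norm dominates its entries. A tall spike thus forces a large operator
  norm.\<close>

lemma op_norm_ge_entry:
  assumes "1 \<le> p" "i < n" "j < n"
  shows "\<bar>A i j\<bar> \<le> op_norm 1 p n A"
proof -
  define e :: "nat \<Rightarrow> real" where "e = (\<lambda>l. if l = j then 1 else 0)"
  have "mat_vec n A e = (\<lambda>i. A i j)"
    using assms by (simp add: mat_vec_def e_def if_distrib cong: if_cong)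
  moreover have "lp_norm 1 n e = 1"
    using assms by (simp add: lp_norm_one e_def if_distrib cong: if_cong)
  moreover have "\<exists>i<n. e i \<noteq> 0"
    using assms by (auto simp: e_def)
  ultimately have "lp_norm p n (\<lambda>i. A i j) \<le> op_norm 1 p n A"
    using op_norm_ge_ratio[of p n e A] assms by auto
  then show ?thesis
    using lp_norm_ge_entry[of p i n "\<lambda>i. A i j"] assms by simp
qed

text \<open>Supplies matrices of any prescribed positive norm, with which the estimator is probed at
  every scale.\<close>

lemma op_norm_corner:
  assumes "1 \<le> p" "0 < n" "0 \<le> t"
  shows "op_norm 1 p n (\<lambda>i j. if i = 0 \<and> j = 0 then t else 0) = t" (is "op_norm 1 p n ?A = t")
proof (rule antisym)
  show "t \<le> op_norm 1 p n ?A"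
    using op_norm_ge_entry[of p 0 n 0 ?A] assms by simp
  show "op_norm 1 p n ?A \<le> t"
    unfolding op_norm_def
  proof (rule cSUP_least)
    show "{x. \<exists>i<n. x i \<noteq> 0} \<noteq> ({} :: (nat \<Rightarrow> real) set)"
      using assms(2) by (auto intro!: exI[of _ "\<lambda>_. 1"] exI[of _ 0])
  next
    fix x :: "nat \<Rightarrow> real" assume "x \<in> {x. \<exists>i<n. x i \<noteq> 0}"
    then obtain i where i: "i < n" "x i \<noteq> 0" by auto
    have pos: "0 < (\<Sum>j<n. \<bar>x j\<bar>)"
      using i by (intro sum_pos2[of _ i]) auto
    have mv: "mat_vec n ?A x i = (if i = 0 then t * x 0 else 0)" for i
    proof -
      have "mat_vec n ?A x i = (\<Sum>j<n. if j = 0 then (if i = 0 then t * x 0 else 0) else 0)"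
        unfolding mat_vec_def by (intro sum.cong) auto
      then show ?thesis using assms(2) by simp
    qed
    have "lp_norm p n (mat_vec n ?A x) = \<bar>t * x 0\<bar>"
      using lp_norm_single[of p n "mat_vec n ?A x"] assms by (simp add: mv)
    moreover have "\<bar>x 0\<bar> \<le> (\<Sum>j<n. \<bar>x j\<bar>)"
      using assms(2) by (intro member_le_sum) auto
    ultimately show "lp_norm p n (mat_vec n ?A x) / lp_norm 1 n x \<le> t"
      using pos assms(3) by (simp add: lp_norm_one abs_mult field_simps mult_left_mono)
  qed
qed

section \<open>Mean norm of a Gaussian vector\<close>

lemma borel_measurable_lp_norm [measurable]:
  assumes "0 < n"
  shows "lp_norm p n \<in> borel_measurable (\<Pi>\<^sub>M i\<in>{..<n}. borel)"
proof (cases "p = \<infinity>")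
  case True
  have "(\<lambda>x. Max ((\<lambda>i. \<bar>x i\<bar>) ` {..<n})) \<in> borel_measurable (\<Pi>\<^sub>M i\<in>{..<n}. (borel :: real measure))"
    by (intro borel_measurable_Max) auto
  then show ?thesis
    using True by (simp add: lp_norm_def[abs_def])
next
  case False
  have "(\<lambda>x. (\<Sum>i<n. \<bar>x i\<bar> powr real_of_ereal p) powr (1 / real_of_ereal p))
      \<in> borel_measurable (\<Pi>\<^sub>M i\<in>{..<n}. borel)"
    by measurable
  then show ?thesis
    using False by (simp add: lp_norm_def[abs_def])
qed

text \<open>The power mean inequality holds pointwise; its expectation involves only the mean of a
  single \<open>\<bar>x i\<bar>\<close>, which is \<open>sqrt (2 / pi)\<close>.\<close>

lemma eta_lower_bound:
  assumes "1 < p" "0 < n"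
  shows "sqrt (2 / pi) * real n powr (1 / real_of_ereal p) \<le> eta p n"
proof -
  let ?N = "density lborel (\<lambda>x. ennreal (std_normal_density x))"
  let ?T = "real n powr (1 / real_of_ereal p)"
  have N: "prob_space ?N"
    by (rule prob_space_normal_density) simp
  have sets: "sets (gaussian_vector n) = sets (\<Pi>\<^sub>M i\<in>{..<n}. borel)"
    unfolding gaussian_vector_def by (intro sets_PiM_cong) auto
  have hb: "has_bochner_integral lborel (\<lambda>x. std_normal_density x * \<bar>x\<bar>) (sqrt (2 / pi))"
    using std_normal_moment_abs_odd[of 0] by simp
  have int1: "integrable ?N (\<lambda>x. \<bar>x\<bar>)" "(\<integral>x. \<bar>x\<bar> \<partial>?N) = sqrt (2 / pi)"
    using hb by (auto simp: has_bochner_integral_iff integrable_real_density integral_real_density)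
  have int: "integrable (gaussian_vector n) (\<lambda>x. \<bar>x i\<bar>)"
    "(\<integral>x. \<bar>x i\<bar> \<partial>gaussian_vector n) = sqrt (2 / pi)" if "i < n" for i
  proof -
    have d: "distr (gaussian_vector n) ?N (\<lambda>x. x i) = ?N"
      unfolding gaussian_vector_def using that N by (intro distr_PiM_component) auto
    have m: "(\<lambda>x. x i) \<in> measurable (gaussian_vector n) ?N"
      unfolding gaussian_vector_def using that by (intro measurable_component_singleton) auto
    show "integrable (gaussian_vector n) (\<lambda>x. \<bar>x i\<bar>)"
      using integrable_distr[OF m, of "\<lambda>x. \<bar>x\<bar>"] int1(1) by (simp only: d)
    show "(\<integral>x. \<bar>x i\<bar> \<partial>gaussian_vector n) = sqrt (2 / pi)"
      using integral_distr[OF m, of "\<lambda>x. \<bar>x\<bar>"] int1(2) by (simp add: d)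
  qed
  \<comment> \<open>Used for integrability only: the Bochner integral of a non-integrable function
    is 0 by default, and \<open>eta\<close> would then say nothing about the norm.\<close>
  have bound: "lp_norm p n x \<le> (\<Sum>i<n. \<bar>x i\<bar>) * ?T" for x
    using assms by (intro lp_norm_le_bound member_le_sum) auto
  have norm_int: "integrable (gaussian_vector n) (lp_norm p n)"
  proof (rule Bochner_Integration.integrable_bound)
    show "integrable (gaussian_vector n) (\<lambda>x. (\<Sum>i<n. \<bar>x i\<bar>) * ?T)"
      using int(1) by auto
    show "lp_norm p n \<in> borel_measurable (gaussian_vector n)"
      using borel_measurable_lp_norm[OF assms(2)] measurable_cong_sets[OF sets refl] by blast
    show "AE x in gaussian_vector n. norm (lp_norm p n x) \<le> norm ((\<Sum>i<n. \<bar>x i\<bar>) * ?T)"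
      using lp_norm_nonneg[of p n] assms bound by (auto simp: sum_nonneg)
  qed
  have "(\<integral>x. ?T * (\<Sum>i<n. \<bar>x i\<bar>) / real n \<partial>gaussian_vector n) \<le> eta p n"
    unfolding eta_def using int(1) norm_int lp_norm_ge_mean[OF assms]
    by (intro integral_mono integrable_divide_zero integrable_mult_right
        Bochner_Integration.integrable_sum) auto
  moreover have "(\<integral>x. ?T * (\<Sum>i<n. \<bar>x i\<bar>) / real n \<partial>gaussian_vector n) = sqrt (2 / pi) * ?T"
    using int assms(2) by simp
  ultimately show ?thesis by simp
qed

subsection \<open>Projection onto the row space\<close>

text \<open>Gram-Schmidt by induction on the number of vectors: \<open>P\<close> is the orthogonal
  projection onto their span, so its trace is the dimension of the span, at most
  \<open>k\<close>.\<close>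

lemma row_space_projection:
  fixes l :: "nat \<Rightarrow> 'a \<Rightarrow> real"
  assumes "finite I"
  shows "\<exists>P. (\<forall>a\<in>I. \<forall>b\<in>I. P a b = P b a) \<and>
    (\<forall>a\<in>I. \<forall>b\<in>I. (\<Sum>c\<in>I. P a c * P c b) = P a b) \<and>
    (\<Sum>a\<in>I. P a a) \<le> real k \<and>
    (\<forall>r<k. \<forall>a\<in>I. (\<Sum>b\<in>I. P a b * l r b) = l r a)"
proof (induction k)
  case 0
  show ?case
    by (intro exI[of _ "\<lambda>_ _. 0"]) auto
next
  case (Suc k)
  then obtain P where sym: "\<And>a b. a \<in> I \<Longrightarrow> b \<in> I \<Longrightarrow> P a b = P b a"
    and idem: "\<And>a b. a \<in> I \<Longrightarrow> b \<in> I \<Longrightarrow> (\<Sum>c\<in>I. P a c * P c b) = P a b"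
    and trace: "(\<Sum>a\<in>I. P a a) \<le> real k"
    and fixed: "\<And>r a. r < k \<Longrightarrow> a \<in> I \<Longrightarrow> (\<Sum>b\<in>I. P a b * l r b) = l r a"
    by blast
  \<comment> \<open>The residual of the new vector after projection onto the old span, and below it
    \<open>d\<close>, its squared length.\<close>
  define v where "v a = l k a - (\<Sum>b\<in>I. P a b * l k b)" for a
  define d where "d = (\<Sum>a\<in>I. v a * v a)"
  have Pv: "(\<Sum>b\<in>I. P a b * v b) = 0" if a: "a \<in> I" for a
  proof -
    have "(\<Sum>b\<in>I. P a b * (\<Sum>c\<in>I. P b c * l k c)) = (\<Sum>c\<in>I. (\<Sum>b\<in>I. P a b * P b c) * l k c)"
      unfolding sum_distrib_left sum_distrib_right by (subst sum.swap) (simp add: mult.assoc)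
    also have "\<dots> = (\<Sum>c\<in>I. P a c * l k c)"
      using a idem by (intro sum.cong) auto
    finally show ?thesis
      by (simp add: v_def right_diff_distrib sum_subtractf)
  qed
  \<comment> \<open>By symmetry of \<open>P\<close> the residual is orthogonal to the range of
    \<open>P\<close>, in particular to every vector that \<open>P\<close> fixes.\<close>
  have vP: "(\<Sum>a\<in>I. v a * (\<Sum>b\<in>I. P a b * f b)) = 0" for f
  proof -
    have "(\<Sum>a\<in>I. v a * (\<Sum>b\<in>I. P a b * f b)) = (\<Sum>b\<in>I. (\<Sum>a\<in>I. P b a * v a) * f b)"
      unfolding sum_distrib_left sum_distrib_right
      by (subst sum.swap) (intro sum.cong refl, simp add: sym mult_ac)
    then show ?thesis
      by (simp add: Pv)
  qed
  have vl: "(\<Sum>a\<in>I. v a * l r a) = 0" if "r < k" for r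
    using vP[of "l r"] fixed[OF that] by simp
  have vlk: "(\<Sum>a\<in>I. v a * l k a) = d"
  proof -
    have "v a * v a = v a * l k a - v a * (\<Sum>b\<in>I. P a b * l k b)" for a
      by (subst (2) v_def) (rule right_diff_distrib)
    then show ?thesis
      by (simp add: d_def sum_subtractf vP)
  qed
  show ?case
  proof (cases "d = 0")
    \<comment> \<open>The new vector already lies in the old span, so \<open>P\<close> still works
      and the trace bound has slack.\<close>
    case True
    then have v0: "v a = 0" if "a \<in> I" for a
      using that assms unfolding d_def by (subst (asm) sum_nonneg_eq_0_iff) auto
    have "(\<Sum>b\<in>I. P a b * l r b) = l r a" if "r < Suc k" "a \<in> I" for r a
      using fixed[of r a] v0[of a] that by (cases "r = k") (auto simp: v_def)
    then show ?thesis
      using sym idem trace by (intro exI[of _ P]) auto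
  next
    case d: False
    \<comment> \<open>Adds the projection onto the line of \<open>v\<close>, whose trace is
      \<open>d / d\<close>; the trace grows by exactly 1.\<close>
    define Q where "Q a b = P a b + v a * v b / d" for a b
    have "(\<Sum>c\<in>I. Q a c * Q c b) = Q a b" if ab: "a \<in> I" "b \<in> I" for a b
    proof -
      have "(\<Sum>c\<in>I. Q a c * Q c b) = (\<Sum>c\<in>I. P a c * P c b) + (\<Sum>c\<in>I. P a c * v c) * (v b / d)
          + v a / d * (\<Sum>c\<in>I. P b c * v c) + v a * v b / (d * d) * (\<Sum>c\<in>I. v c * v c)"
        unfolding sum_distrib_left sum_distrib_right sum.distrib[symmetric] using sym[OF ab(2)]
        by (intro sum.cong refl) (simp add: Q_def algebra_simps add_divide_distrib)
      then show ?thesis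
        using d by (simp add: idem Pv ab d_def[symmetric] Q_def)
    qed
    moreover have "(\<Sum>a\<in>I. Q a a) \<le> real (Suc k)"
      using trace d by (simp add: Q_def sum.distrib sum_divide_distrib[symmetric] d_def[symmetric])
    moreover have "(\<Sum>b\<in>I. Q a b * l r b) = l r a" if "r < Suc k" "a \<in> I" for r a
    proof -
      have "(\<Sum>b\<in>I. Q a b * l r b) = (\<Sum>b\<in>I. P a b * l r b) + v a / d * (\<Sum>b\<in>I. v b * l r b)"
        unfolding sum_distrib_left sum.distrib[symmetric]
        by (intro sum.cong refl) (simp add: Q_def algebra_simps add_divide_distrib)
      then show ?thesis
        using that fixed[of r a] vl[of r] vlk d by (cases "r = k") (auto simp: v_def)
    qed
    moreover have "Q a b = Q b a" if "a \<in> I" "b \<in> I" for a b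
      using sym[OF that] by (simp add: Q_def mult.commute)
    ultimately show ?thesis
      by (intro exI[of _ Q]) auto
  qed
qed

subsection \<open>The noise distribution\<close>

text \<open>
  The noise density is the square of \<open>bump\<close>; since \<open>bump\<close> is Lipschitz with compact support, the
  Hellinger affinity of the density with its translate by w is 1 - O(w^2).
\<close>

definition bump :: "real \<Rightarrow> real" where
  "bump x = sqrt 30 * max 0 (x * (1 - x))"

lemma bump_nonneg [simp]: "0 \<le> bump x"
  by (simp add: bump_def)

lemma bump_measurable [measurable]: "bump \<in> borel_measurable borel"
  unfolding bump_def[abs_def] by measurable

lemma bump_eq_0: "x \<notin> {0<..<1} \<Longrightarrow> bump x = 0"
  by (auto simp: bump_def max_def mult_le_0_iff not_less zero_le_mult_iff)

lemma bump_square: "(bump x)\<^sup>2 = 30 * (x * (1 - x))\<^sup>2 * indicator {0..1} x"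
  by (auto simp: bump_def max_def power_mult_distrib zero_le_mult_iff not_le split: split_indicator)

text \<open>On the unit interval the difference of two values of the parabola is
  \<open>(x - y) * (1 - x - y)\<close>, whose second factor is at most 1 in absolute value. A
  one-sided bound suffices by symmetry.\<close>

lemma bump_lipschitz: "\<bar>bump x - bump y\<bar> \<le> sqrt 30 * \<bar>x - y\<bar>"
proof -
  let ?h = "\<lambda>x::real. max 0 (x * (1 - x))"
  have one_sided: "?h x - ?h y \<le> \<bar>x - y\<bar>" for x y
  proof (cases "0 < x \<and> x < 1")
    case False
    then have "?h x = 0"
      by (auto simp: max_def mult_le_0_iff not_less zero_le_mult_iff)
    then show ?thesis by auto
  next
    case x: True
    then have hx: "?h x = x * (1 - x)" by (simp add: max_def)
    \<comment> \<open>For \<open>y\<close> outside the unit interval: the value at \<open>x\<close>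
      is at most the distance from \<open>x\<close> to either endpoint, hence at most the distance
      to \<open>y\<close>.\<close>
    have le: "x * (1 - x) \<le> x" "x * (1 - x) \<le> 1 - x"
      using x by (auto simp: mult_left_le mult_left_le_one_le)
    show ?thesis
    proof (cases "0 \<le> y \<and> y \<le> 1")
      case True
      then have "?h y = y * (1 - y)"
        by (intro max_absorb2) simp
      then have "?h x - ?h y = (x - y) * (1 - x - y)"
        unfolding hx by (simp add: algebra_simps)
      also have "\<dots> \<le> \<bar>x - y\<bar> * \<bar>1 - x - y\<bar>"
        by (metis abs_ge_self abs_mult)
      also have "\<dots> \<le> \<bar>x - y\<bar> * 1"
        using x True by (intro mult_left_mono) auto
      finally show ?thesis by simp
    next
      case False
      moreover have "0 \<le> ?h y" by simp
      ultimately show ?thesis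
        using x le hx by linarith
    qed
  qed
  have "\<bar>?h x - ?h y\<bar> \<le> \<bar>x - y\<bar>"
    using one_sided[of x y] one_sided[of y x] by (simp add: abs_le_iff abs_minus_commute)
  then have "sqrt 30 * \<bar>?h x - ?h y\<bar> \<le> sqrt 30 * \<bar>x - y\<bar>"
    by (intro mult_left_mono) auto
  then show ?thesis
    by (simp add: bump_def abs_mult flip: right_diff_distrib)
qed

lemma has_bochner_integral_bump_square: "has_bochner_integral lborel (\<lambda>x. (bump x)\<^sup>2) 1"
proof -
  \<comment> \<open>The integral of \<open>(x * (1 - x))\<^sup>2\<close> over the unit interval is
    1/30, whence the factor \<open>sqrt 30\<close> in \<open>bump\<close>; \<open>F\<close> is the
    antiderivative of the normalised density.\<close>
  define F where "F x = 10 * x ^ 3 - 15 * x ^ 4 + 6 * x ^ 5" for x :: real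
  have "has_bochner_integral lborel
      (\<lambda>x. 30 * (x * (1 - x))\<^sup>2 * indicator {0..1} x) (F 1 - F 0)"
  proof (rule has_bochner_integral_FTC_Icc_real)
    fix x :: real
    show "(F has_real_derivative 30 * (x * (1 - x))\<^sup>2) (at x)"
      unfolding F_def by (auto intro!: derivative_eq_intros simp: power2_eq_square algebra_simps
          power3_eq_cube power4_eq_xxxx)
  qed auto
  then show ?thesis
    by (simp add: F_def bump_square)
qed

lemma has_bochner_integral_bump_shift_square:
  "has_bochner_integral lborel (\<lambda>x. (bump (x - w))\<^sup>2) 1"
  using lborel_has_bochner_integral_real_affine_iff[of 1 "\<lambda>x. (bump x)\<^sup>2" 1 "- w"]
    has_bochner_integral_bump_square by simp

lemma integrable_bump_mult: "integrable lborel (\<lambda>x. bump (x - v) * bump (x - w))"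
proof (rule Bochner_Integration.integrable_bound)
  show "integrable lborel (\<lambda>x. (bump (x - v))\<^sup>2 + (bump (x - w))\<^sup>2)"
    using has_bochner_integral_bump_shift_square by (auto simp: has_bochner_integral_iff)
  show "AE x in lborel. norm (bump (x - v) * bump (x - w))
      \<le> norm ((bump (x - v))\<^sup>2 + (bump (x - w))\<^sup>2)"
  proof (intro AE_I2)
    fix x
    have "2 * bump (x - v) * bump (x - w) \<le> (bump (x - v))\<^sup>2 + (bump (x - w))\<^sup>2"
      by (rule sum_squares_bound)
    moreover have nonneg: "0 \<le> bump (x - v) * bump (x - w)" by simp
    ultimately have "bump (x - v) * bump (x - w) \<le> (bump (x - v))\<^sup>2 + (bump (x - w))\<^sup>2"
      by linarith
    then show "norm (bump (x - v) * bump (x - w)) \<le> norm ((bump (x - v))\<^sup>2 + (bump (x - w))\<^sup>2)"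
      using nonneg by simp
  qed
qed simp

section \<open>Hellinger affinity of the noise density and its translates\<close>

definition affinity :: "real \<Rightarrow> real" where
  "affinity w = (\<integral>x. bump x * bump (x - w) \<partial>lborel)"

text \<open>The squared difference of \<open>bump\<close> and its translate integrates to 2 minus
  twice the affinity. Nonnegativity gives the upper bound; the Lipschitz constant and two supports
  of length 1 bound the integral by \<open>60 * w\<^sup>2\<close>, which gives the last
  claim.\<close>

lemma affinity_bounds: "0 \<le> affinity w" "affinity w \<le> 1" "1 - 30 * w\<^sup>2 \<le> affinity w"
proof -
  have int: "integrable lborel (\<lambda>x. (bump x)\<^sup>2)" "integrable lborel (\<lambda>x. (bump (x - w))\<^sup>2)"
    "integrable lborel (\<lambda>x. bump x * bump (x - w))"
    using has_bochner_integral_bump_square has_bochner_integral_bump_shift_square[of w]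
      integrable_bump_mult[of 0 w] by (auto simp: has_bochner_integral_iff)
  have I: "(\<integral>x. (bump x)\<^sup>2 \<partial>lborel) = 1" "(\<integral>x. (bump (x - w))\<^sup>2 \<partial>lborel) = 1"
    using has_bochner_integral_bump_square has_bochner_integral_bump_shift_square[of w]
    by (auto simp: has_bochner_integral_iff)
  have expand: "(bump x - bump (x - w))\<^sup>2 = (bump x)\<^sup>2 + (bump (x - w))\<^sup>2 - 2 * (bump x * bump (x - w))"
    for x by (simp add: power2_diff)
  have int_diff: "integrable lborel (\<lambda>x. (bump x - bump (x - w))\<^sup>2)"
    unfolding expand using int by auto
  have diff: "(\<integral>x. (bump x - bump (x - w))\<^sup>2 \<partial>lborel) = 2 - 2 * affinity w"
    unfolding expand affinity_def using int I by simp
  show "0 \<le> affinity w"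
    unfolding affinity_def by (intro integral_nonneg_AE) simp
  have "0 \<le> (\<integral>x. (bump x - bump (x - w))\<^sup>2 \<partial>lborel)"
    by (intro integral_nonneg_AE) simp
  then show "affinity w \<le> 1"
    unfolding diff by simp
  have "(\<integral>x. (bump x - bump (x - w))\<^sup>2 \<partial>lborel)
      \<le> (\<integral>x. 30 * w\<^sup>2 * (indicator {0..1} x + indicator {w..w+1} x) \<partial>lborel)"
  proof (intro integral_mono int_diff)
    fix x :: real
    show "(bump x - bump (x - w))\<^sup>2 \<le> 30 * w\<^sup>2 * (indicator {0..1} x + indicator {w..w+1} x)"
    proof (cases "x \<in> {0..1} \<or> x \<in> {w..w+1}")
      case True
      have "(bump x - bump (x - w))\<^sup>2 \<le> (sqrt 30 * \<bar>w\<bar>)\<^sup>2"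
        using bump_lipschitz[of x "x - w"] by (subst abs_le_square_iff[symmetric]) (simp add: abs_mult)
      also have "\<dots> = 30 * w\<^sup>2 * 1"
        by (simp add: power_mult_distrib)
      also have "\<dots> \<le> 30 * w\<^sup>2 * (indicator {0..1} x + indicator {w..w+1} x)"
        using True by (intro mult_left_mono) (auto split: split_indicator)
      finally show ?thesis .
    next
      case False
      then have "bump x = 0" "bump (x - w) = 0"
        by (auto intro!: bump_eq_0)
      then show ?thesis by (auto split: split_indicator)
    qed
  qed simp
  then have "2 - 2 * affinity w \<le> 60 * w\<^sup>2"
    unfolding diff by simp
  then show "1 - 30 * w\<^sup>2 \<le> affinity w" by simp
qed

section \<open>Product noise\<close>

abbreviation lborel_Pi :: "'a set \<Rightarrow> ('a \<Rightarrow> real) measure" where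
  "lborel_Pi I \<equiv> (\<Pi>\<^sub>M i\<in>I. lborel)"

interpretation lborel_product: product_sigma_finite "\<lambda>_. lborel :: real measure"
  by standard

text \<open>The square root of the density of noise shifted by \<open>w\<close>. With roots, the
  affinity of two shifts is an L2 inner product that factors over coordinates.\<close>

definition bump_prod :: "'a set \<Rightarrow> ('a \<Rightarrow> real) \<Rightarrow> ('a \<Rightarrow> real) \<Rightarrow> real" where
  "bump_prod I w x = (\<Prod>i\<in>I. bump (x i - w i))"

lemma bump_prod_measurable [measurable]: "bump_prod I w \<in> borel_measurable (lborel_Pi I)"
  unfolding bump_prod_def[abs_def] by measurable

lemma bump_prod_integrable_mult:
  assumes "finite I"
  shows "integrable (lborel_Pi I) (\<lambda>x. bump_prod I v x * bump_prod I w x)"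
  unfolding bump_prod_def prod.distrib[symmetric]
  by (intro lborel_product.product_integrable_prod assms integrable_bump_mult)

lemma bump_prod_integral_mult:
  assumes "finite I"
  shows "(\<integral>x. bump_prod I v x * bump_prod I w x \<partial>lborel_Pi I)
    = (\<Prod>i\<in>I. \<integral>x. bump (x - v i) * bump (x - w i) \<partial>lborel)"
  unfolding bump_prod_def prod.distrib[symmetric]
  by (intro lborel_product.product_integral_prod assms integrable_bump_mult)

lemma bump_prod_integral_square:
  assumes "finite I"
  shows "(\<integral>x. (bump_prod I w x)\<^sup>2 \<partial>lborel_Pi I) = 1"
  using bump_prod_integral_mult[OF assms, of w w] has_bochner_integral_bump_shift_square
  by (simp add: power2_eq_square has_bochner_integral_iff)

text \<open>The affinity is a product over coordinates; the Weierstrass inequality turns the product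
  of \<open>1 - (1 - affinity (w i))\<close> into a sum, so only the squared length of
  \<open>w\<close> matters.\<close>

lemma bump_prod_affinity_ge:
  assumes "finite I"
  shows "1 - 30 * (\<Sum>i\<in>I. (w i)\<^sup>2) \<le> (\<integral>x. bump_prod I (\<lambda>_. 0) x * bump_prod I w x \<partial>lborel_Pi I)"
proof -
  have "1 - 30 * (\<Sum>i\<in>I. (w i)\<^sup>2) \<le> 1 - (\<Sum>i\<in>I. 1 - affinity (w i))"
    unfolding sum_distrib_left using affinity_bounds(3)[of "w _"]
    by (intro diff_left_mono sum_mono) (simp add: algebra_simps)
  also have "\<dots> \<le> (\<Prod>i\<in>I. 1 - (1 - affinity (w i)))"
    using affinity_bounds(1,2) by (intro Weierstrass_prod_ineq) auto
  finally show ?thesis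
    by (simp add: bump_prod_integral_mult[OF assms] affinity_def)
qed

definition noise :: "'a set \<Rightarrow> ('a \<Rightarrow> real) \<Rightarrow> ('a \<Rightarrow> real) measure" where
  "noise I w = density (lborel_Pi I) (\<lambda>x. ennreal ((bump_prod I w x)\<^sup>2))"

lemma sets_noise [simp, measurable_cong]: "sets (noise I w) = sets (lborel_Pi I)"
  by (simp add: noise_def)

lemma space_noise [simp]: "space (noise I w) = space (lborel_Pi I)"
  by (simp add: noise_def)

lemma integrable_bump_prod_square:
  assumes "finite I"
  shows "integrable (lborel_Pi I) (\<lambda>x. (bump_prod I w x)\<^sup>2)"
  using bump_prod_integrable_mult[OF assms, of w w] by (simp add: power2_eq_square)

lemma prob_space_noise:
  assumes "finite I"
  shows "prob_space (noise I w)"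
proof (rule prob_spaceI)
  have "emeasure (noise I w) (space (noise I w)) = (\<integral>\<^sup>+x. ennreal ((bump_prod I w x)\<^sup>2) \<partial>lborel_Pi I)"
    unfolding noise_def by (subst emeasure_density) (auto intro!: nn_integral_cong)
  also have "\<dots> = 1"
    by (subst nn_integral_eq_integral)
       (simp_all add: integrable_bump_prod_square bump_prod_integral_square assms)
  finally show "emeasure (noise I w) (space (noise I w)) = 1" .
qed

text \<open>\<open>bump\<close> vanishes outside the open unit interval. Strictness also makes the
  unshifted noise matrix nonzero almost surely, as the guarantee of a sketching family
  demands.\<close>

lemma AE_noise:
  assumes "finite I"
  shows "AE x in noise I w. \<forall>i\<in>I. w i < x i \<and> x i < w i + 1"
proof -
  have "w i < x i \<and> x i < w i + 1" if "bump_prod I w x \<noteq> 0" "i \<in> I" for x i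
  proof -
    have "bump (x i - w i) \<noteq> 0"
      using that assms by (auto simp: bump_prod_def)
    then have "x i - w i \<in> {0<..<1}"
      using bump_eq_0 by blast
    then show ?thesis by auto
  qed
  then show ?thesis
    unfolding noise_def by (subst AE_density) (auto intro!: AE_I2)
qed

lemma measure_noise:
  assumes "finite I" "B \<in> sets (lborel_Pi I)"
  shows "measure (noise I w) B = (\<integral>x. (bump_prod I w x)\<^sup>2 * indicator B x \<partial>lborel_Pi I)"
proof -
  interpret prob_space "noise I w"
    by (rule prob_space_noise) fact
  have "ennreal (measure (noise I w) B) = emeasure (noise I w) B"
    by (simp add: emeasure_eq_measure)
  also have "\<dots> = (\<integral>\<^sup>+x. ennreal ((bump_prod I w x)\<^sup>2) * indicator B x \<partial>lborel_Pi I)"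
    unfolding noise_def using assms(2) by (intro emeasure_density) auto
  also have "\<dots> = (\<integral>\<^sup>+x. ennreal ((bump_prod I w x)\<^sup>2 * indicator B x) \<partial>lborel_Pi I)"
    by (intro nn_integral_cong) (auto split: split_indicator)
  also have "\<dots> = ennreal (\<integral>x. (bump_prod I w x)\<^sup>2 * indicator B x \<partial>lborel_Pi I)"
    using assms integrable_bump_prod_square[OF assms(1), of w]
    by (intro nn_integral_eq_integral integrable_real_mult_indicator) auto
  finally show ?thesis
    by (simp add: integral_nonneg_AE)
qed

text \<open>
  Weighted AM-GM on \<open>v\<^sup>2 - u\<^sup>2 = (v - u)(v + u)\<close> replaces the Cauchy-Schwarz bound of total variation by
  Hellinger distance; it keeps the bound linear in the squared length of w, so that it can be averaged.
\<close>

lemma measure_noise_shift_le: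
  assumes "finite I" and B [measurable]: "B \<in> sets (lborel_Pi I)" and "0 < t"
  shows "measure (noise I w) B \<le> measure (noise I (\<lambda>_. 0)) B + 30 * t * (\<Sum>i\<in>I. (w i)\<^sup>2) + 2 / t"
proof -
  let ?M = "lborel_Pi I" and ?u = "bump_prod I (\<lambda>_. 0)" and ?v = "bump_prod I w"
  define \<rho> where "\<rho> = (\<integral>x. ?u x * ?v x \<partial>?M)"
  have int: "integrable ?M (\<lambda>x. (?u x)\<^sup>2)" "integrable ?M (\<lambda>x. (?v x)\<^sup>2)" "integrable ?M (\<lambda>x. ?u x * ?v x)"
    using integrable_bump_prod_square bump_prod_integrable_mult assms(1) by auto
  note I = bump_prod_integral_square[OF assms(1)]
  have intB: "integrable ?M (\<lambda>x. (?u x)\<^sup>2 * indicator B x)" "integrable ?M (\<lambda>x. (?v x)\<^sup>2 * indicator B x)"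
    using int by (auto intro!: integrable_real_mult_indicator)
  \<comment> \<open>Coefficients with \<open>h * r = 1 / 4\<close>, as AM-GM requires;
    \<open>t\<close> weighs the difference of the two roots against their sum.\<close>
  define h r where "h = t / 2" and "r = 1 / (2 * t)"
  have pw: "(?v x)\<^sup>2 * indicator B x - (?u x)\<^sup>2 * indicator B x
      \<le> (h + r) * (?u x)\<^sup>2 + (h + r) * (?v x)\<^sup>2 + 2 * (r - h) * (?u x * ?v x)" for x
  proof -
    have am_gm: "\<bar>c * d\<bar> \<le> h * c\<^sup>2 + r * d\<^sup>2" for c d :: real
    proof -
      have "0 \<le> (t * \<bar>c\<bar> - \<bar>d\<bar>)\<^sup>2 / (2 * t)"
        using assms(3) by simp
      also have "\<dots> = h * c\<^sup>2 + r * d\<^sup>2 - \<bar>c * d\<bar>"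
        using assms(3) by (simp add: h_def r_def power2_diff abs_mult field_simps power2_eq_square)
      finally show ?thesis by simp
    qed
    have "(?v x)\<^sup>2 * indicator B x - (?u x)\<^sup>2 * indicator B x \<le> \<bar>(?v x - ?u x) * (?v x + ?u x)\<bar>"
      by (auto simp: power2_eq_square algebra_simps split: split_indicator)
    also have "\<dots> \<le> h * (?v x - ?u x)\<^sup>2 + r * (?v x + ?u x)\<^sup>2"
      by (rule am_gm)
    also have "\<dots> = (h + r) * (?u x)\<^sup>2 + (h + r) * (?v x)\<^sup>2
        + 2 * (r - h) * (?u x * ?v x)"
      by (simp add: power2_eq_square algebra_simps)
    finally show ?thesis .
  qed
  have "measure (noise I w) B - measure (noise I (\<lambda>_. 0)) B
      = (\<integral>x. (?v x)\<^sup>2 * indicator B x - (?u x)\<^sup>2 * indicator B x \<partial>?M)"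
    using intB assms by (simp add: measure_noise)
  also have "\<dots> \<le> (\<integral>x. (h + r) * (?u x)\<^sup>2 + (h + r) * (?v x)\<^sup>2
      + 2 * (r - h) * (?u x * ?v x) \<partial>?M)"
    by (intro integral_mono pw Bochner_Integration.integrable_diff intB Bochner_Integration.integrable_add
        integrable_mult_right int)
  also have "\<dots> = (h + r) * 1 + (h + r) * 1 + 2 * (r - h) * \<rho>"
    using int I[of "\<lambda>_. 0"] I[of w]
    by (simp only: \<rho>_def Bochner_Integration.integral_add integrable_mult_right
        Bochner_Integration.integrable_add integral_mult_right_zero)
  \<comment> \<open>The squared L2 norms of \<open>?v - ?u\<close> and \<open>?v + ?u\<close> are
    \<open>2 - 2 * \<rho>\<close> and \<open>2 + 2 * \<rho>\<close>: the first is controlled by the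
    affinity, the second is at most 4.\<close>
  also have "\<dots> = t * (1 - \<rho>) + (1 + \<rho>) / t"
    using assms(3) by (simp add: h_def r_def field_simps)
  also have "\<dots> \<le> t * (30 * (\<Sum>i\<in>I. (w i)\<^sup>2)) + 2 / t"
  proof (intro add_mono mult_left_mono divide_right_mono)
    show "1 - \<rho> \<le> 30 * (\<Sum>i\<in>I. (w i)\<^sup>2)"
      using bump_prod_affinity_ge[OF assms(1), of w] by (simp add: \<rho>_def)
    have "\<rho> = (\<Prod>i\<in>I. affinity (w i))"
      by (simp add: \<rho>_def bump_prod_integral_mult[OF assms(1)] affinity_def)
    also have "\<dots> \<le> 1"
      using affinity_bounds(1,2) by (intro prod_le_1) auto
    finally show "1 + \<rho> \<le> 2" by simp
  qed (use assms(3) in auto)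
  finally show ?thesis by (simp add: algebra_simps)
qed

section \<open>Translating the noise\<close>

lemma lborel_Pi_translate:
  assumes "finite I"
  shows "distr (lborel_Pi I) (lborel_Pi I) (\<lambda>x. \<lambda>i\<in>I. x i + v i) = lborel_Pi I"
proof (rule lborel_product.PiM_eqI[OF assms])
  fix A :: "'a \<Rightarrow> real set" assume A: "\<And>i. i \<in> I \<Longrightarrow> A i \<in> sets lborel"
  have m: "(\<lambda>x. \<lambda>i\<in>I. x i + v i) \<in> measurable (lborel_Pi I) (lborel_Pi I)"
    by measurable
  have "emeasure (distr (lborel_Pi I) (lborel_Pi I) (\<lambda>x. \<lambda>i\<in>I. x i + v i)) (Pi\<^sub>E I A)
      = emeasure (lborel_Pi I) ((\<lambda>x. \<lambda>i\<in>I. x i + v i) -` Pi\<^sub>E I A \<inter> space (lborel_Pi I))"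
    using A assms m by (intro emeasure_distr sets_PiM_I_finite) auto
  also have "(\<lambda>x. \<lambda>i\<in>I. x i + v i) -` Pi\<^sub>E I A \<inter> space (lborel_Pi I)
      = Pi\<^sub>E I (\<lambda>i. (+) (v i) -` A i)"
    by (auto simp: space_PiM PiE_def Pi_def extensional_def add.commute)
  also have "emeasure (lborel_Pi I) \<dots> = (\<Prod>i\<in>I. emeasure lborel ((+) (v i) -` A i))"
    using A assms by (intro lborel_product.emeasure_PiM) (auto intro: measurable_sets_borel[of _ borel])
  also have "\<dots> = (\<Prod>i\<in>I. emeasure lborel (A i))"
  proof (intro prod.cong refl)
    fix i assume "i \<in> I"
    then have "emeasure (distr lborel borel ((+) (v i))) (A i) = emeasure lborel ((+) (v i) -` A i)"
      using A by (subst emeasure_distr) auto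
    then show "emeasure lborel ((+) (v i) -` A i) = emeasure lborel (A i)"
      by (simp add: lborel_distr_plus)
  qed
  finally show "emeasure (distr (lborel_Pi I) (lborel_Pi I) (\<lambda>x. \<lambda>i\<in>I. x i + v i)) (Pi\<^sub>E I A)
      = (\<Prod>i\<in>I. emeasure lborel (A i))" .
qed simp

text \<open>Translation invariance of Lebesgue measure lets the density follow the change of
  variables. A shift of the noise thereby becomes a shift of the event.\<close>

lemma distr_noise_translate:
  assumes "finite I"
  shows "distr (noise I w) (lborel_Pi I) (\<lambda>x. \<lambda>i\<in>I. x i + v i) = noise I (\<lambda>i. w i + v i)"
    (is "distr _ _ ?\<tau> = _")
proof -
  have [measurable]: "?\<tau> \<in> measurable (lborel_Pi I) (lborel_Pi I)"
    by measurable
  have "bump_prod I w x = bump_prod I (\<lambda>i. w i + v i) (?\<tau> x)" for x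
    by (simp add: bump_prod_def)
  then have "noise I w = density (lborel_Pi I) (\<lambda>x. ennreal ((bump_prod I (\<lambda>i. w i + v i) (?\<tau> x))\<^sup>2))"
    unfolding noise_def by simp
  also have "distr \<dots> (lborel_Pi I) ?\<tau>
      = density (distr (lborel_Pi I) (lborel_Pi I) ?\<tau>) (\<lambda>x. ennreal ((bump_prod I (\<lambda>i. w i + v i) x)\<^sup>2))"
    by (rule density_distr[symmetric]) measurable
  finally show ?thesis
    by (simp only: lborel_Pi_translate[OF assms] noise_def)
qed

subsection \<open>Distinguishing noise from noise with a spike\<close>

text \<open>
  An event of positive measure is measurable, and \<open>L \<mapsto> L(A)\<close> has a measurable right inverse when
  A is nonzero; so the family property itself forces f to be Borel on the preimages of positive
  open intervals. Without this, the exchange of integrals over L and over the noise would fail.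
\<close>

lemma estimator_superlevel_measurable:
  assumes fam: "sketching_family 1 p n k \<kappa> S f"
    and p: "1 \<le> p" and n: "0 < n" and \<kappa>: "1 < \<kappa>" and c: "0 < c"
  shows "{y \<in> space (\<Pi>\<^sub>M r\<in>{..<k}. borel). c < f y} \<in> sets (\<Pi>\<^sub>M r\<in>{..<k}. borel)"
proof -
  let ?Y = "\<Pi>\<^sub>M r\<in>{..<k}. (borel :: real measure)"
  have band: "{y \<in> space ?Y. f y \<in> {1 / \<kappa> * t <..< \<kappa> * t}} \<in> sets ?Y" if t: "0 < t" for t
  proof -
    define A where "A = (\<lambda>(i :: nat) (j :: nat). if i = 0 \<and> j = 0 then t else 0)"
    have norm: "op_norm 1 p n A = t"
      unfolding A_def using op_norm_corner[of p n t] p n t by simp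
    define ev where "ev = {L \<in> space S. f (apply_map n k L A) \<in> {1 / \<kappa> * t <..< \<kappa> * t}}"
    have "\<exists>i<n. \<exists>j<n. A i j \<noteq> 0"
      using n t by (auto simp: A_def)
    then have "5 / 6 \<le> measure S ev"
      using fam norm by (auto simp: sketching_family_def ev_def)
    then have "ev \<in> sets S"
      using measure_notin_sets[of ev S] by auto
    then have ev: "ev \<in> sets (linear_maps n k)"
      using fam by (auto simp: sketching_family_def)
    \<comment> \<open>The right inverse: a map whose corner coefficients are divided by
      \<open>t\<close> reproduces \<open>y\<close>, since the corner entry \<open>t\<close> is the
      only nonzero entry of \<open>A\<close>.\<close>
    define \<sigma> where "\<sigma> = (\<lambda>y :: nat \<Rightarrow> real. \<lambda>u\<in>{..<k} \<times> {..<n} \<times> {..<n}.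
      if snd u = (0, 0) then y (fst u) / t else 0)"
    have \<sigma>: "\<sigma> \<in> measurable ?Y (linear_maps n k)"
      unfolding \<sigma>_def linear_maps_def
    proof (rule measurable_restrict)
      fix u :: "nat \<times> nat \<times> nat" assume "u \<in> {..<k} \<times> {..<n} \<times> {..<n}"
      then have "(\<lambda>y. y (fst u)) \<in> borel_measurable ?Y"
        by (intro measurable_component_singleton) auto
      then show "(\<lambda>y. if snd u = (0, 0) then y (fst u) / t else 0) \<in> borel_measurable ?Y"
        by auto
    qed
    have "apply_map n k (\<sigma> y) A = y" if "y \<in> space ?Y" for y
    proof
      fix r
      show "apply_map n k (\<sigma> y) A r = y r"
      proof (cases "r < k")
        case True
        have "(\<Sum>i<n. \<Sum>j<n. \<sigma> y (r, i, j) * A i j)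
            = (\<Sum>i<n. \<Sum>j<n. if j = 0 then (if i = 0 then y r else 0) else 0)"
          using True t by (intro sum.cong refl) (auto simp: \<sigma>_def A_def)
        also have "\<dots> = y r"
          using n by simp
        finally show ?thesis
          using True by (simp add: apply_map_def)
      next
        case False
        then show ?thesis
          using that by (auto simp: apply_map_def space_PiM PiE_def extensional_def)
      qed
    qed
    moreover have "space S = space (linear_maps n k)"
      using fam unfolding sketching_family_def by (intro sets_eq_imp_space_eq) simp
    ultimately have "{y \<in> space ?Y. f y \<in> {1 / \<kappa> * t <..< \<kappa> * t}} = \<sigma> -` ev \<inter> space ?Y"
      using measurable_space[OF \<sigma>] by (auto simp: ev_def)
    then show ?thesis
      using measurable_sets[OF \<sigma> ev] by simp
  qed
  \<comment> \<open>The band for \<open>m\<close> runs from \<open>c * \<kappa> ^ m\<close> to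
    \<open>c * \<kappa> ^ (m + 2)\<close>. Consecutive open bands overlap, so countably many cover
    all values above \<open>c\<close>; \<open>m\<close> is one below the least \<open>N\<close> with
    \<open>v \<le> c * \<kappa> ^ N\<close>.\<close>
  have "\<exists>m. v \<in> {1 / \<kappa> * (c * \<kappa> ^ Suc m) <..< \<kappa> * (c * \<kappa> ^ Suc m)}" if v: "c < v" for v
  proof -
    define N where "N = (LEAST N. v \<le> c * \<kappa> ^ N)"
    obtain N0 where "v / c < \<kappa> ^ N0"
      using real_arch_pow[OF \<kappa>] by blast
    then have "v \<le> c * \<kappa> ^ N0"
      using c by (simp add: field_simps)
    then have N: "v \<le> c * \<kappa> ^ N"
      unfolding N_def by (rule LeastI)
    then have "N \<noteq> 0"
      using v by (intro notI) simp
    then obtain m where m: "N = Suc m"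
      by (cases N) auto
    have "\<not> v \<le> c * \<kappa> ^ m"
      using not_less_Least[of m "\<lambda>N. v \<le> c * \<kappa> ^ N"] m by (simp add: N_def)
    moreover have "c * \<kappa> ^ Suc m < \<kappa> * (c * \<kappa> ^ Suc m)"
      using c \<kappa> by simp
    moreover have "1 / \<kappa> * (c * \<kappa> ^ Suc m) = c * \<kappa> ^ m"
      using \<kappa> by simp
    ultimately have "1 / \<kappa> * (c * \<kappa> ^ Suc m) < v" "v < \<kappa> * (c * \<kappa> ^ Suc m)"
      using N unfolding m by linarith+
    then show ?thesis
      unfolding greaterThanLessThan_iff by blast
  qed
  moreover have "c \<le> 1 / \<kappa> * (c * \<kappa> ^ Suc m)" for m
    using c \<kappa> one_le_power[of \<kappa> m] by simp
  ultimately have "{y \<in> space ?Y. c < f y}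
      = (\<Union>m. {y \<in> space ?Y. f y \<in> {1 / \<kappa> * (c * \<kappa> ^ Suc m) <..< \<kappa> * (c * \<kappa> ^ Suc m)}})"
    by (fastforce intro: le_less_trans)
  also have "\<dots> \<in> sets ?Y"
    using c \<kappa> by (intro sets.countable_UN image_subsetI band) auto
  finally show ?thesis .
qed

text \<open>Fubini-Tonelli in two forms: a real integral with the first component fixed, which can
  be summed and averaged, and a nonnegative integral with the second fixed, to which
  almost-everywhere bounds apply.\<close>

lemma prob_pair_sections:
  assumes "prob_space M" "prob_space N" and E: "E \<in> sets (M \<Otimes>\<^sub>M N)"
  shows "integrable M (\<lambda>x. measure N (Pair x -` E))"
    and "(\<integral>x. measure N (Pair x -` E) \<partial>M) = measure (M \<Otimes>\<^sub>M N) E"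
    and "emeasure (M \<Otimes>\<^sub>M N) E = (\<integral>\<^sup>+y. emeasure M ((\<lambda>x. (x, y)) -` E) \<partial>N)"
proof -
  interpret M: prob_space M by fact
  interpret N: prob_space N by fact
  interpret pair_prob_space M N ..
  have "(\<lambda>x. measure N (Pair x -` E)) \<in> borel_measurable M"
    unfolding measure_def using N.measurable_emeasure_Pair[OF E] by measurable
  then show int: "integrable M (\<lambda>x. measure N (Pair x -` E))"
    by (intro M.integrable_const_bound[where B = 1]) auto
  have "ennreal (measure (M \<Otimes>\<^sub>M N) E) = (\<integral>\<^sup>+x. ennreal (measure N (Pair x -` E)) \<partial>M)"
    using N.emeasure_pair_measure_alt[OF E] by (simp add: emeasure_eq_measure N.emeasure_eq_measure)
  also have "\<dots> = ennreal (\<integral>x. measure N (Pair x -` E) \<partial>M)"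
    using int by (intro nn_integral_eq_integral) auto
  finally show "(\<integral>x. measure N (Pair x -` E) \<partial>M) = measure (M \<Otimes>\<^sub>M N) E"
    by (simp add: integral_nonneg_AE)
  show "emeasure (M \<Otimes>\<^sub>M N) E = (\<integral>\<^sup>+y. emeasure M ((\<lambda>x. (x, y)) -` E) \<partial>N)"
    by (rule emeasure_pair_measure_alt2) fact
qed

text \<open>The bound for each \<open>n\<close>: the detection probability is at least 5/6 with a
  spike and at most 1/6 without, so the shifts caused by the spikes must on average be visible,
  which forces a large trace and hence a large \<open>k\<close>.\<close>

theorem sketch_dimension_lower_bound:
  assumes fam: "sketching_family 1 p n k \<kappa> S f"
    and p: "1 \<le> p" and n: "0 < n" and \<kappa>: "1 < \<kappa>"
  shows "(real n)\<^sup>2 \<le> 540 * \<kappa> ^ 4 * (real n powr (1 / real_of_ereal p))\<^sup>2 * real k"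
proof -
  define T where "T = real n powr (1 / real_of_ereal p)"
  define s where "s = \<kappa>\<^sup>2 * T"
  have T: "0 < T" using n by (simp add: T_def)
  define I where "I = {..<n} \<times> {..<n}"
  have [simp]: "finite I" by (simp add: I_def)
  have cardI: "real (card I) = (real n)\<^sup>2"
    by (simp add: I_def power2_eq_square)
  let ?Y = "\<Pi>\<^sub>M r\<in>{..<k}. (borel :: real measure)"
  \<comment> \<open>The threshold \<open>\<kappa> * T\<close> separates the cases: norm at most
    \<open>T\<close> puts a successful estimate below it, norm above
    \<open>s = \<kappa>\<^sup>2 * T\<close> puts it above.\<close>
  define B where "B = {y \<in> space ?Y. \<kappa> * T < f y}"
  have B: "B \<in> sets ?Y"
    unfolding B_def using \<kappa> T by (intro estimator_superlevel_measurable[OF fam p n]) auto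
  interpret S: prob_space S
    using fam by (simp add: sketching_family_def)
  have setsS: "sets S = sets (linear_maps n k)"
    using fam by (simp add: sketching_family_def)
  have success: "5 / 6 \<le> S.prob {L \<in> space S. f (apply_map n k L A)
      \<in> {1 / \<kappa> * op_norm 1 p n A <..< \<kappa> * op_norm 1 p n A}}" if "i < n" "j < n" "A i j \<noteq> 0" for A i j
    using fam that by (auto simp: sketching_family_def)
  \<comment> \<open>Matrices become functions on index pairs, so that the noise lives on a single
    product space.\<close>
  define ap where "ap L x = apply_map n k L (\<lambda>i j. x (i, j))" for L and x :: "nat \<times> nat \<Rightarrow> real"
  have ap_eq: "ap L x = (\<lambda>r\<in>{..<k}. \<Sum>a\<in>I. L (r, a) * x a)" for L x
    unfolding ap_def apply_map_def I_def by (simp add: sum.cartesian_product case_prod_unfold)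
  have ap_meas: "(\<lambda>z. ap (fst z) (snd z)) \<in> measurable (S \<Otimes>\<^sub>M lborel_Pi I) ?Y"
    unfolding ap_eq
  proof (rule measurable_restrict, rule borel_measurable_sum)
    fix r a assume r: "r \<in> {..<k}" and a: "a \<in> I"
    have "(\<lambda>L. L (r, a)) \<in> borel_measurable (linear_maps n k)"
      unfolding linear_maps_def using r a
      by (intro measurable_component_singleton) (auto simp: I_def)
    then have "(\<lambda>L. L (r, a)) \<in> borel_measurable S"
      using measurable_cong_sets[OF setsS refl] by blast
    then have 1: "(\<lambda>z. fst z (r, a)) \<in> borel_measurable (S \<Otimes>\<^sub>M lborel_Pi I)"
      by (rule measurable_compose[OF measurable_fst])
    have "(\<lambda>x. x a) \<in> borel_measurable (lborel_Pi I)"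
      using measurable_component_singleton[OF a, of "\<lambda>_. lborel"] by simp
    then have 2: "(\<lambda>z. snd z a) \<in> borel_measurable (S \<Otimes>\<^sub>M lborel_Pi I)"
      by (rule measurable_compose[OF measurable_snd])
    show "(\<lambda>z. fst z (r, a) * snd z a) \<in> borel_measurable (S \<Otimes>\<^sub>M lborel_Pi I)"
      using 1 2 by measurable
  qed
  define E where "E = {z \<in> space (S \<Otimes>\<^sub>M lborel_Pi I). ap (fst z) (snd z) \<in> B}"
  have E: "E \<in> sets (S \<Otimes>\<^sub>M noise I w)" for w
  proof -
    have "E = (\<lambda>z. ap (fst z) (snd z)) -` B \<inter> space (S \<Otimes>\<^sub>M lborel_Pi I)"
      by (auto simp: E_def)
    then have "E \<in> sets (S \<Otimes>\<^sub>M lborel_Pi I)"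
      using measurable_sets[OF ap_meas B] by simp
    then show ?thesis
      by (simp cong: sets_pair_measure_cong)
  qed
  define D where "D L = {x \<in> space (lborel_Pi I). ap L x \<in> B}" for L
  have D: "Pair L -` E = D L" if "L \<in> space S" for L
    using that by (auto simp: E_def D_def space_pair_measure)
  have D_sets: "D L \<in> sets (lborel_Pi I)" if "L \<in> space S" for L
    using sets_Pair1[OF E[of "\<lambda>_. 0"], of L] D[OF that] by simp
  have sect: "(\<lambda>L. (L, x)) -` E = {L \<in> space S. ap L x \<in> B}" if "x \<in> space (lborel_Pi I)" for x
    using that by (auto simp: E_def space_pair_measure)
  have sect_sets: "{L \<in> space S. ap L x \<in> B} \<in> sets S" if "x \<in> space (lborel_Pi I)" for x
    using sets_Pair2[OF E[of "\<lambda>_. 0"], of x] sect[OF that] by simp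
  have ap_space: "ap L x \<in> space ?Y" for L x
    by (simp add: ap_eq space_PiM)
  note noise_prob = prob_space_noise[OF \<open>finite I\<close>]
  note sections = prob_pair_sections[OF S.prob_space_axioms noise_prob E, of w for w]
  \<comment> \<open>The probability, over sketch and noise shifted by \<open>w\<close>, that the
    estimate exceeds the threshold. It is estimated by fixing the matrix first and compared between
    shifts by fixing \<open>L\<close> first.\<close>
  define Q where "Q w = (\<integral>L. measure (noise I w) (D L) \<partial>S)" for w
  have Q_int: "integrable S (\<lambda>L. measure (noise I w) (D L))" for w
    using sections(1)[of w]
    by (rule Bochner_Integration.integrable_cong[THEN iffD1, rotated -1]) (auto simp: D)
  have "ennreal (Q w) = emeasure (S \<Otimes>\<^sub>M noise I w) E" for w
  proof -
    interpret N: prob_space "noise I w" by (rule noise_prob)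
    interpret pair_prob_space S "noise I w" ..
    have "Q w = measure (S \<Otimes>\<^sub>M noise I w) E"
      unfolding Q_def sections(2)[symmetric] by (intro Bochner_Integration.integral_cong) (auto simp: D)
    then show ?thesis
      by (simp add: emeasure_eq_measure)
  qed
  then have Q: "ennreal (Q w) = (\<integral>\<^sup>+x. emeasure S ((\<lambda>L. (L, x)) -` E) \<partial>noise I w)" for w
    by (simp add: sections(3))
  have entry: "x (i, j) \<le> op_norm 1 p n (\<lambda>i j. x (i, j))" if "i < n" "j < n" for x i j
    using op_norm_ge_entry[OF p that, of "\<lambda>i j. x (i, j)"] by simp

  define spike where "spike a = (\<lambda>b. if b = a then s else 0)" for a :: "nat \<times> nat"
  have Q_spike: "5 / 6 \<le> Q (spike a)" if a: "a \<in> I" for a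
  proof -
    interpret N: prob_space "noise I (spike a)" by (rule noise_prob)
    have "AE x in noise I (spike a). x \<in> space (lborel_Pi I) \<and> s < x a"
      using AE_noise[OF \<open>finite I\<close>, of "spike a"] AE_space
      by eventually_elim (use a in \<open>auto simp: spike_def\<close>)
    then have "AE x in noise I (spike a). ennreal (5 / 6) \<le> emeasure S ((\<lambda>L. (L, x)) -` E)"
    proof eventually_elim
      fix x assume x: "x \<in> space (lborel_Pi I) \<and> s < x a"
      obtain i j where ij: "a = (i, j)" "i < n" "j < n"
        using a by (auto simp: I_def)
      have "0 < s" using \<kappa> T by (simp add: s_def)
      then have nz: "x (i, j) \<noteq> 0" using x ij by auto
      have "s < op_norm 1 p n (\<lambda>i j. x (i, j))"
        using entry[OF ij(2,3), of x] x ij(1) by simp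
      then have big: "\<kappa> * T < 1 / \<kappa> * op_norm 1 p n (\<lambda>i j. x (i, j))"
        using \<kappa> by (simp add: s_def field_simps power2_eq_square)
      have "5 / 6 \<le> S.prob {L \<in> space S. f (ap L x) \<in> {1 / \<kappa> * op_norm 1 p n (\<lambda>i j. x (i, j))
          <..< \<kappa> * op_norm 1 p n (\<lambda>i j. x (i, j))}}"
        unfolding ap_def by (rule success[of i j "\<lambda>i j. x (i, j)"]) (use ij nz in auto)
      also have "\<dots> \<le> S.prob {L \<in> space S. ap L x \<in> B}"
        using big sect_sets x ap_space by (intro S.finite_measure_mono) (auto simp: B_def)
      finally show "ennreal (5 / 6) \<le> emeasure S ((\<lambda>L. (L, x)) -` E)"
        using x by (simp add: sect S.emeasure_eq_measure ennreal_leI)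
    qed
    then have "(\<integral>\<^sup>+x. ennreal (5 / 6) \<partial>noise I (spike a)) \<le> ennreal (Q (spike a))"
      unfolding Q by (rule nn_integral_mono_AE)
    then have "ennreal (5 / 6) \<le> ennreal (Q (spike a))"
      using N.emeasure_space_1 by simp
    then show ?thesis
      by (subst (asm) ennreal_le_iff2) auto
  qed

  have Q_zero: "Q (\<lambda>_. 0) \<le> 1 / 6"
  proof -
    interpret N: prob_space "noise I (\<lambda>_. 0)" by (rule noise_prob)
    have "AE x in noise I (\<lambda>_. 0). x \<in> space (lborel_Pi I) \<and> (\<forall>a\<in>I. 0 < x a \<and> x a < 1)"
      using AE_noise[OF \<open>finite I\<close>, of "\<lambda>_. 0"] AE_space by eventually_elim auto
    then have "AE x in noise I (\<lambda>_. 0). emeasure S ((\<lambda>L. (L, x)) -` E) \<le> ennreal (1 / 6)"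
    proof eventually_elim
      fix x assume x: "x \<in> space (lborel_Pi I) \<and> (\<forall>a\<in>I. 0 < x a \<and> x a < 1)"
      have ij: "0 < x (i, j)" "x (i, j) < 1" if "i < n" "j < n" for i j
        using x that by (auto simp: I_def)
      have "op_norm 1 p n (\<lambda>i j. x (i, j)) \<le> 1 * real n powr (1 / real_of_ereal p)"
        using ij by (intro op_norm_le_bound p n) (simp add: less_imp_le)
      then have small: "\<kappa> * op_norm 1 p n (\<lambda>i j. x (i, j)) \<le> \<kappa> * T"
        using \<kappa> by (simp add: T_def)
      have "5 / 6 \<le> S.prob {L \<in> space S. f (ap L x) \<in> {1 / \<kappa> * op_norm 1 p n (\<lambda>i j. x (i, j))
          <..< \<kappa> * op_norm 1 p n (\<lambda>i j. x (i, j))}}"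
        unfolding ap_def using ij[of 0 0] n by (intro success[of 0 0]) auto
      also have "\<dots> \<le> S.prob (space S - {L \<in> space S. ap L x \<in> B})"
        using small sect_sets x by (intro S.finite_measure_mono) (auto simp: B_def)
      also have "\<dots> = 1 - S.prob {L \<in> space S. ap L x \<in> B}"
        using sect_sets x by (intro S.prob_compl) auto
      finally show "emeasure S ((\<lambda>L. (L, x)) -` E) \<le> ennreal (1 / 6)"
        using x by (simp add: sect S.emeasure_eq_measure ennreal_leI)
    qed
    then have "ennreal (Q (\<lambda>_. 0)) \<le> (\<integral>\<^sup>+x. ennreal (1 / 6) \<partial>noise I (\<lambda>_. 0))"
      unfolding Q by (rule nn_integral_mono_AE)
    then have "ennreal (Q (\<lambda>_. 0)) \<le> ennreal (1 / 6)"
      using N.emeasure_space_1 by simp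
    then show ?thesis
      by (subst (asm) ennreal_le_iff) auto
  qed

  have pointwise: "(\<Sum>a\<in>I. measure (noise I (spike a)) (D L))
      \<le> real (card I) * measure (noise I (\<lambda>_. 0)) (D L) + (180 * s\<^sup>2 * real k + real (card I) / 3)"
    if L: "L \<in> space S" for L
  proof -
    obtain P where sym: "\<And>a b. a \<in> I \<Longrightarrow> b \<in> I \<Longrightarrow> P a b = P b a"
      and idem: "\<And>a b. a \<in> I \<Longrightarrow> b \<in> I \<Longrightarrow> (\<Sum>c\<in>I. P a c * P c b) = P a b"
      and trace: "(\<Sum>a\<in>I. P a a) \<le> real k"
      and row: "\<And>r a. r < k \<Longrightarrow> a \<in> I \<Longrightarrow> (\<Sum>b\<in>I. P a b * L (r, b)) = L (r, a)"
      using row_space_projection[OF \<open>finite I\<close>, of k "\<lambda>r a. L (r, a)"] by blast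
    \<comment> \<open>L cannot tell the spike from its projection onto the row space, which is short on average.\<close>
    define w where "w a = (\<lambda>b. s * P a b)" for a
    \<comment> \<open>By linearity the right-hand side depends on \<open>v\<close> only through its
      sketch, so shifts with equal sketches give equal probabilities.\<close>
    have translate: "measure (noise I v) (D L)
        = measure (noise I (\<lambda>_. 0)) {x \<in> space (lborel_Pi I). (\<lambda>r\<in>{..<k}. ap L x r + ap L v r) \<in> B}"
      for v
    proof -
      have "measure (noise I v) (D L)
          = measure (distr (noise I (\<lambda>_. 0)) (lborel_Pi I) (\<lambda>x. \<lambda>i\<in>I. x i + v i)) (D L)"
        using distr_noise_translate[OF \<open>finite I\<close>, of "\<lambda>_. 0" v] by simp
      also have "\<dots> = measure (noise I (\<lambda>_. 0)) ((\<lambda>x. \<lambda>i\<in>I. x i + v i) -` D L \<inter> space (noise I (\<lambda>_. 0)))"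
      proof (rule measure_distr)
        show "(\<lambda>x. \<lambda>i\<in>I. x i + v i) \<in> measurable (noise I (\<lambda>_. 0)) (lborel_Pi I)"
          by measurable
      qed (rule D_sets[OF L])
      also have "(\<lambda>x. \<lambda>i\<in>I. x i + v i) -` D L \<inter> space (noise I (\<lambda>_. 0))
          = {x \<in> space (lborel_Pi I). (\<lambda>r\<in>{..<k}. ap L x r + ap L v r) \<in> B}"
      proof -
        have "ap L (\<lambda>i\<in>I. x i + v i) = (\<lambda>r\<in>{..<k}. ap L x r + ap L v r)" for x
          by (auto simp: ap_eq fun_eq_iff sum.distrib distrib_left)
        then show ?thesis
          by (auto simp: D_def space_PiM)
      qed
      finally show ?thesis .
    qed
    have "measure (noise I (spike a)) (D L)
        \<le> measure (noise I (\<lambda>_. 0)) (D L) + 180 * s\<^sup>2 * P a a + 1 / 3" if a: "a \<in> I" for a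
    proof -
      have "ap L (spike a) = ap L (w a)"
      proof -
        have "(\<Sum>b\<in>I. L (r, b) * spike a b) = (\<Sum>b\<in>I. L (r, b) * w a b)" if "r < k" for r
        proof -
          have "(\<Sum>b\<in>I. L (r, b) * spike a b) = s * L (r, a)"
            using a by (simp add: spike_def if_distrib cong: if_cong)
          also have "\<dots> = (\<Sum>b\<in>I. L (r, b) * w a b)"
            unfolding row[OF that a, symmetric] by (simp add: w_def sum_distrib_left mult_ac)
          finally show ?thesis .
        qed
        then show ?thesis
          by (auto simp: ap_eq fun_eq_iff)
      qed
      then have "measure (noise I (spike a)) (D L) = measure (noise I (w a)) (D L)"
        by (simp add: translate)
      \<comment> \<open>The weight \<open>t = 6\<close> makes the constant loss 1/3, strictly less
        than the gap 5/6 - 1/6.\<close>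
      also have "\<dots> \<le> measure (noise I (\<lambda>_. 0)) (D L) + 30 * 6 * (\<Sum>b\<in>I. (w a b)\<^sup>2) + 2 / 6"
        by (intro measure_noise_shift_le D_sets[OF L]) auto
      \<comment> \<open>Symmetry and idempotency turn the squared length of a row of
        \<open>P\<close> into a diagonal entry; summing over \<open>a\<close> then produces the
        trace.\<close>
      also have "(\<Sum>b\<in>I. (w a b)\<^sup>2) = s\<^sup>2 * (\<Sum>b\<in>I. P a b * P b a)"
        unfolding sum_distrib_left using sym[OF a]
        by (intro sum.cong refl) (simp add: w_def power2_eq_square)
      also have "\<dots> = s\<^sup>2 * P a a"
        using idem[OF a a] by simp
      finally show ?thesis by simp
    qed
    then have "(\<Sum>a\<in>I. measure (noise I (spike a)) (D L))
        \<le> (\<Sum>a\<in>I. measure (noise I (\<lambda>_. 0)) (D L) + 180 * s\<^sup>2 * P a a + 1 / 3)"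
      by (rule sum_mono)
    also have "\<dots> = real (card I) * measure (noise I (\<lambda>_. 0)) (D L)
        + (180 * s\<^sup>2 * (\<Sum>a\<in>I. P a a) + real (card I) / 3)"
      by (simp add: sum.distrib sum_distrib_left)
    also have "\<dots> \<le> real (card I) * measure (noise I (\<lambda>_. 0)) (D L)
        + (180 * s\<^sup>2 * real k + real (card I) / 3)"
      using trace by (intro add_mono mult_left_mono order_refl) auto
    finally show ?thesis .
  qed

  \<comment> \<open>Averaging over positions and over \<open>L\<close> leaves 5/6 - 1/6 - 1/3 = 1/3
    of \<open>card I\<close> against \<open>180 * s\<^sup>2 * real k\<close>, whence 540.\<close>
  have "real (card I) * (5 / 6) \<le> (\<Sum>a\<in>I. Q (spike a))"
    using sum_mono[of I "\<lambda>_. 5 / 6" "\<lambda>a. Q (spike a)"] Q_spike by simp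
  also have "\<dots> = (\<integral>L. (\<Sum>a\<in>I. measure (noise I (spike a)) (D L)) \<partial>S)"
    unfolding Q_def using Q_int by simp
  also have "\<dots> \<le> (\<integral>L. real (card I) * measure (noise I (\<lambda>_. 0)) (D L)
      + (180 * s\<^sup>2 * real k + real (card I) / 3) \<partial>S)"
    using Q_int pointwise by (intro integral_mono) auto
  also have "\<dots> = real (card I) * Q (\<lambda>_. 0) + (180 * s\<^sup>2 * real k + real (card I) / 3)"
    using Q_int by (simp add: Q_def S.prob_space)
  also have "\<dots> \<le> real (card I) * (1 / 6) + (180 * s\<^sup>2 * real k + real (card I) / 3)"
    using Q_zero by (intro add_mono mult_left_mono) auto
  finally have "real (card I) \<le> 540 * s\<^sup>2 * real k"
    by (simp add: algebra_simps)
  then show ?thesis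
    by (simp add: cardI s_def T_def power_mult_distrib)
qed

section \<open>Asymptotic forms of the bound\<close>

theorem theorem4p7:
  fixes p :: ereal and \<kappa> :: real
  assumes "p > 2" and "\<kappa> > 1"
  shows "(\<exists>c>0. \<forall>\<^sub>F n in sequentially. \<forall>k S f. sketching_family 1 p n k \<kappa> S f \<longrightarrow>
            real k \<ge> c * ((real n)\<^sup>2 / (eta p n)\<^sup>2)) \<and>
         (p < \<infinity> \<longrightarrow>
           (\<exists>c>0. \<forall>\<^sub>F n in sequentially. \<forall>k S f. sketching_family 1 p n k \<kappa> S f \<longrightarrow>
             real k \<ge> c * real n powr (2 - 2 / real_of_ereal p))) \<and>
         (p = \<infinity> \<longrightarrow>
           (\<exists>c>0. \<forall>\<^sub>F n in sequentially. \<forall>k S f. sketching_family 1 p n k \<kappa> S f \<longrightarrow>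
             real k \<ge> c * ((real n)\<^sup>2 / ln (real n))))"
proof -
  have p: "1 < p"
    using assms(1) by (cases p) auto
  define C where "C = 1 / (540 * \<kappa> ^ 4)"
  define T where "T n = real n powr (1 / real_of_ereal p)" for n
  have C: "0 < C"
    using assms(2) by (simp add: C_def)
  have T: "0 < T n" if "0 < n" for n
    using that by (simp add: T_def)
  have main: "C * ((real n)\<^sup>2 / (T n)\<^sup>2) \<le> real k"
    if "0 < n" "sketching_family 1 p n k \<kappa> S f" for n k S f
    using sketch_dimension_lower_bound[OF that(2) less_imp_le[OF p] that(1) assms(2)]
      T[OF that(1)] assms(2)
    by (simp add: C_def T_def[symmetric] field_simps)
  \<comment> \<open>The factor \<open>2 / pi\<close> is the square of the constant in
    \<open>eta_lower_bound\<close>; it carries the bound from \<open>T\<close> over to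
    \<open>eta\<close>.\<close>
  have "C * (2 / pi) * ((real n)\<^sup>2 / (eta p n)\<^sup>2) \<le> C * ((real n)\<^sup>2 / (T n)\<^sup>2)" if n: "0 < n" for n
  proof -
    have le: "sqrt (2 / pi) * T n \<le> eta p n"
      unfolding T_def by (rule eta_lower_bound[OF p n])
    have pos: "0 < sqrt (2 / pi) * T n"
      using T[OF n] by simp
    have "(2 / pi) * (T n)\<^sup>2 = (sqrt (2 / pi) * T n)\<^sup>2"
      by (simp add: power_mult_distrib)
    also have "\<dots> \<le> (eta p n)\<^sup>2"
      using le pos by (intro power_mono) auto
    finally have "(2 / pi) * (T n)\<^sup>2 \<le> (eta p n)\<^sup>2" .
    moreover have "0 < eta p n"
      using le pos by linarith
    ultimately have "(2 / pi) * ((real n)\<^sup>2 / (eta p n)\<^sup>2) \<le> (2 / pi) * ((real n)\<^sup>2 / ((2 / pi) * (T n)\<^sup>2))"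
      using T[OF n] by (intro mult_left_mono divide_left_mono) auto
    also have "\<dots> = (real n)\<^sup>2 / (T n)\<^sup>2"
      by simp
    finally show ?thesis
      using C unfolding mult.assoc by (intro mult_left_mono) auto
  qed
  then have eta_bound: "C * (2 / pi) * ((real n)\<^sup>2 / (eta p n)\<^sup>2) \<le> real k"
    if "0 < n" "sketching_family 1 p n k \<kappa> S f" for n k S f
    using main[OF that] that(1) order_trans by blast
  have finite_bound: "C * real n powr (2 - 2 / real_of_ereal p) \<le> real k"
    if "0 < n" "sketching_family 1 p n k \<kappa> S f" for n k S f
  proof -
    have "real n powr (2 - 2 / real_of_ereal p) = (real n)\<^sup>2 / (T n)\<^sup>2"
      using that(1) by (simp add: T_def powr_diff powr_power)
    then show ?thesis
      using main[OF that] by simp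
  qed
  \<comment> \<open>Here \<open>T n\<close> is 1, so \<open>main\<close> gives a quadratic bound;
    from \<open>n = 3\<close> on, \<open>ln (real n)\<close> is at least 1 because
    \<open>exp 1 \<le> 3\<close>, and dividing by it only lowers the claim.\<close>
  have infinite_bound: "C * ((real n)\<^sup>2 / ln (real n)) \<le> real k"
    if "p = \<infinity>" "3 \<le> n" "sketching_family 1 p n k \<kappa> S f" for n k S f
  proof -
    have "1 \<le> ln (real n)"
      using that(2) exp_le by (subst ln_ge_iff) auto
    then have "(real n)\<^sup>2 / ln (real n) \<le> (real n)\<^sup>2 / 1"
      by (intro divide_left_mono) auto
    then have "C * ((real n)\<^sup>2 / ln (real n)) \<le> C * (real n)\<^sup>2"
      using C by (intro mult_left_mono) auto
    then show ?thesis
      using main[of n k S f] that by (simp add: T_def)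
  qed
  show ?thesis
  proof (intro conjI impI)
    show "\<exists>c>0. \<forall>\<^sub>F n in sequentially. \<forall>k S f. sketching_family 1 p n k \<kappa> S f \<longrightarrow>
        real k \<ge> c * ((real n)\<^sup>2 / (eta p n)\<^sup>2)"
      using C eta_bound by (intro exI[of _ "C * (2 / pi)"] conjI eventually_sequentiallyI[of 1]) auto
    show "\<exists>c>0. \<forall>\<^sub>F n in sequentially. \<forall>k S f. sketching_family 1 p n k \<kappa> S f \<longrightarrow>
        real k \<ge> c * real n powr (2 - 2 / real_of_ereal p)"
      using C finite_bound by (intro exI[of _ C] conjI eventually_sequentiallyI[of 1]) auto
    show "\<exists>c>0. \<forall>\<^sub>F n in sequentially. \<forall>k S f. sketching_family 1 p n k \<kappa> S f \<longrightarrow>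
        real k \<ge> c * ((real n)\<^sup>2 / ln (real n))" if "p = \<infinity>"
      using C infinite_bound[OF that] by (intro exI[of _ C] conjI eventually_sequentiallyI[of 3]) auto
  qed
qed

end
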